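(* For any cardinal $\kappa$, the following are equivalent: (1) $\kappa<\operatorname{add}(\mathfrak{X},\mathfrak{D})$; (2) for each sequence $\langle (g_\alpha,\mathcal{F}_\alpha):\alpha<\kappa\rangle$ such that each $g_\alpha\in\mathbb{N}^{\mathbb{N}}$, each $\mathcal{F}_\alpha\subseteq[\mathbb{N}]^\infty$, and for each $\alpha$ the restriction $\mathcal{F}_\alpha\|\{n:0<g_\alpha(n)\}$ is large and linearly quasiordered by $\subseteq^*$, there exists $h\in\mathbb{N}^{\mathbb{N}}$ such that for each $\alpha<\kappa$ the restriction $\mathcal{F}_\alpha\|\{n:g_\alpha(n)\le h(n)\}$ is large.
   Context: $[\mathbb{N}]^\infty$ is the family of infinite subsets of $\mathbb{N}$; $A\subseteq^*B$ means $A\setminus B$ is finite. For $\mathcal{F}\subseteq[\mathbb{N}]^\infty$ and $A\subseteq\mathbb{N}$, $\mathcal{F}\|A=\{B\cap A:B\in\mathcal{F}\}$, called large if all its members are infinite. $\mathbb{N}^{\mathbb{N}}$ is the set of functions $\mathbb{N}\to\mathbb{N}$; $f\le^*g$ means $f(n)\le g(n)$ for all but finitely many $n$; a subset of $\mathbb{N}^{\mathbb{N}}$ is dominating if it is $\le^*$-cofinal. For $Y\subseteq\mathbb{N}^{\mathbb{N}}$, $g$ avoids middles in $Y$ if $\{n:f(n)<g(n)\}$ is infinite for each $f\in Y$, and for all $f,h\in Y$ at least one of $\{n:f(n)<g(n)\le h(n)\}$, $\{n:h(n)<g(n)\le f(n)\}$ is finite. $\mathfrak{X}$ is the class of $Y\subseteq\mathbb{N}^{\mathbb{N}}$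 for which some $g$ avoids middles in $Y$; $\mathfrak{D}$ is the class of non-dominating subsets. $\operatorname{add}(\mathfrak{X},\mathfrak{D})$ is the minimal cardinality of a family $\mathcal{F}\subseteq\mathfrak{X}$ with $\bigcup\mathcal{F}$ dominating. *)

theory Defs
  imports Main
begin

unbundle cardinal_syntax

definition infinite_sets :: "nat set set" where
  "infinite_sets = {A. infinite A}"

definition almost_subset :: "nat set \<Rightarrow> nat set \<Rightarrow> bool"  (infix "\<subseteq>\<^sup>*" 50) where
  "A \<subseteq>\<^sup>* B \<longleftrightarrow> finite (A - B)"

definition restriction :: "nat set set \<Rightarrow> nat set \<Rightarrow> nat set set"  (infixl "\<parallel>" 65) where
  "F \<parallel> A = {B \<inter> A |B. B \<in> F}"

definition large :: "nat set set \<Rightarrow> bool" where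
  "large F \<longleftrightarrow> (\<forall>A\<in>F. infinite A)"

(* A linear quasiorder is a total preorder; antisymmetry is not required. *)
definition linearly_quasiordered :: "('a \<Rightarrow> 'a \<Rightarrow> bool) \<Rightarrow> 'a set \<Rightarrow> bool" where
  "linearly_quasiordered R S \<longleftrightarrow>
     preorder_on S (relation_of R S) \<and> total_on S (relation_of R S)"

definition le_star :: "(nat \<Rightarrow> nat) \<Rightarrow> (nat \<Rightarrow> nat) \<Rightarrow> bool"  (infix "\<le>\<^sup>*" 50) where
  "f \<le>\<^sup>* g \<longleftrightarrow> finite {n. \<not> f n \<le> g n}"

definition dominating :: "(nat \<Rightarrow> nat) set \<Rightarrow> bool" where
  "dominating Y \<longleftrightarrow> (\<forall>f. \<exists>g\<in>Y. f \<le>\<^sup>* g)"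

definition avoids_middles :: "(nat \<Rightarrow> nat) \<Rightarrow> (nat \<Rightarrow> nat) set \<Rightarrow> bool" where
  "avoids_middles g Y \<longleftrightarrow>
     (\<forall>f\<in>Y. infinite {n. f n < g n}) \<and>
     (\<forall>f\<in>Y. \<forall>h\<in>Y. finite {n. f n < g n \<and> g n \<le> h n} \<or>
                   finite {n. h n < g n \<and> g n \<le> f n})"

definition class_X :: "(nat \<Rightarrow> nat) set set"  ("\<XX>") where
  "\<XX> = {Y. \<exists>g. avoids_middles g Y}"

definition class_D :: "(nat \<Rightarrow> nat) set set"  ("\<DD>") where
  "\<DD> = {Y. \<not> dominating Y}"

definition is_add_witness :: "'a set set \<Rightarrow> 'a set set \<Rightarrow> 'a set set \<Rightarrow> bool" where
  "is_add_witness I J F \<longleftrightarrow> F \<subseteq> I \<and> \<Union>F \<notin> J"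

(* The minimal cardinality of a family of members of I whose union is not in J, as a
   cardinal order relation.  It is meaningful only if there is such a family, which for
   the two classes above is the lemma add_X_D_minimal below. *)
definition add_number :: "'a set set \<Rightarrow> 'a set set \<Rightarrow> 'a set rel"  ("add'(_,/ _')") where
  "add(I, J) = |SOME F. is_add_witness I J F \<and> (\<forall>G. is_add_witness I J G \<longrightarrow> |F| \<le>o |G| )|"

lemma add_number_minimal:
  assumes "is_add_witness I J H"
  shows "\<exists>F. is_add_witness I J F \<and> add(I, J) = |F|"
    and "is_add_witness I J G \<Longrightarrow> add(I, J) \<le>o |G|"
proof -
  let ?P = "\<lambda>F. is_add_witness I J F \<and> (\<forall>G. is_add_witness I J G \<longrightarrow> |F| \<le>o |G| )"
  have "\<exists>r \<in> card_of ` {F. is_add_witness I J F}.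
        \<forall>r' \<in> card_of ` {F. is_add_witness I J F}. r \<le>o r'"
    using assms by (intro exists_minim_Card_order) (auto simp: card_of_Card_order)
  then have "\<exists>F. ?P F" by auto
  then have P: "?P (SOME F. ?P F)" by (rule someI_ex)
  then show "\<exists>F. is_add_witness I J F \<and> add(I, J) = |F|"
    unfolding add_number_def by blast
  show "is_add_witness I J G \<Longrightarrow> add(I, J) \<le>o |G|"
    using P unfolding add_number_def by blast
qed

lemma is_add_witness_X_D: "is_add_witness \<XX> \<DD> F \<longleftrightarrow> F \<subseteq> \<XX> \<and> dominating (\<Union>F)"
  by (simp add: is_add_witness_def class_D_def)

lemma add_X_D_minimal:
  shows "\<exists>F. F \<subseteq> \<XX> \<and> dominating (\<Union>F) \<and> add(\<XX>, \<DD>) = |F|"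
    and "G \<subseteq> \<XX> \<Longrightarrow> dominating (\<Union>G) \<Longrightarrow> add(\<XX>, \<DD>) \<le>o |G|"
proof -
  have "{f} \<in> \<XX>" for f
  proof -
    have "avoids_middles (\<lambda>n. Suc (f n)) {f}"
      by (auto simp: avoids_middles_def)
    then show ?thesis by (auto simp: class_X_def)
  qed
  moreover have "dominating (\<Union> (range (\<lambda>f. {f})))"
    unfolding dominating_def
  proof
    fix f :: "nat \<Rightarrow> nat"
    show "\<exists>g \<in> \<Union> (range (\<lambda>f. {f})). f \<le>\<^sup>* g"
      by (rule bexI[of _ f]) (auto simp: le_star_def)
  qed
  ultimately have w: "is_add_witness \<XX> \<DD> (range (\<lambda>f. {f}))"
    by (auto simp: is_add_witness_X_D)
  show "\<exists>F. F \<subseteq> \<XX> \<and> dominating (\<Union>F) \<and> add(\<XX>, \<DD>) = |F|"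
    using add_number_minimal(1)[OF w] by (auto simp: is_add_witness_X_D)
  show "G \<subseteq> \<XX> \<Longrightarrow> dominating (\<Union>G) \<Longrightarrow> add(\<XX>, \<DD>) \<le>o |G|"
    using add_number_minimal(2)[OF w] by (auto simp: is_add_witness_X_D)
qed

end

(* The passage between the two sides is given by the sets {n. f n < g n}.  If g avoids middles
   in Y, these sets, for f in Y, form a chain of infinite sets for the almost inclusion.
   Conversely, given such a chain and a function g, which may be enlarged to be positive and
   nondecreasing once F has been replaced by its restriction, every set A of the chain is
   {n. f n < g n} for the function f that is g - 1 on A and, off A, is the value of g at the
   next element of A.  A nondecreasing h that is not eventually bounded by f then satisfies
   g \<le> h infinitely often on A. *)

theory Submission
  imports Defs "HOL-Library.Infinite_Set"
begin

text \<open>Almost inclusion is always a preorder, since \<open>A - C\<close> lies in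
  \<open>(A - B) \<union> (B - C)\<close>; only comparability remains to be checked.\<close>

lemma linearly_quasiordered_almost_subset_iff:
  "linearly_quasiordered (\<subseteq>\<^sup>*) S \<longleftrightarrow> (\<forall>A\<in>S. \<forall>B\<in>S. A \<subseteq>\<^sup>* B \<or> B \<subseteq>\<^sup>* A)"
proof -
  have refl: "A \<subseteq>\<^sup>* A" for A
    by (simp add: almost_subset_def)
  have trans: "A \<subseteq>\<^sup>* C" if "A \<subseteq>\<^sup>* B" "B \<subseteq>\<^sup>* C" for A B C
    using that unfolding almost_subset_def
    by (rule_tac finite_subset[of _ "(A - B) \<union> (B - C)"]) auto
  have "preorder_on S (relation_of (\<subseteq>\<^sup>*) S)"
    unfolding preorder_on_def refl_on_def trans_def relation_of_def
    using refl trans by blast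
  then show ?thesis
    unfolding linearly_quasiordered_def total_on_def relation_of_def
    using refl by (auto, metis)
qed

text \<open>A middle \<open>{n. f n < g n \<and> g n \<le> h n}\<close> is the difference of
  \<open>{n. f n < g n}\<close> and \<open>{n. h n < g n}\<close>, so its finiteness is an almost
  inclusion.\<close>

lemma avoids_middles_iff:
  "avoids_middles g Y \<longleftrightarrow>
    (\<forall>f\<in>Y. infinite {n. f n < g n}) \<and>
    (\<forall>f\<in>Y. \<forall>h\<in>Y. {n. f n < g n} \<subseteq>\<^sup>* {n. h n < g n} \<or> {n. h n < g n} \<subseteq>\<^sup>* {n. f n < g n})"
proof -
  have "{n. f n < g n} - {n. h n < g n} = {n. f n < g n \<and> g n \<le> h n}" for f h :: "nat \<Rightarrow> nat"
    by auto
  then show ?thesis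
    unfolding avoids_middles_def almost_subset_def by simp
qed

definition next_in :: "nat set \<Rightarrow> nat \<Rightarrow> nat" where
  "next_in A n = (LEAST m. m \<in> A \<and> n \<le> m)"

lemma next_in:
  assumes "infinite A"
  shows "next_in A n \<in> A" and "n \<le> next_in A n"
proof -
  have "\<exists>m. m \<in> A \<and> n \<le> m"
    using assms by (auto simp: infinite_nat_iff_unbounded_le)
  from LeastI_ex[OF this] show "next_in A n \<in> A" and "n \<le> next_in A n"
    by (auto simp: next_in_def)
qed

definition step_function :: "(nat \<Rightarrow> nat) \<Rightarrow> nat set \<Rightarrow> nat \<Rightarrow> nat" where
  "step_function g A n = (if n \<in> A then g n - 1 else g (next_in A n))"

text \<open>Positivity keeps the truncated \<open>g n - 1\<close> strictly below \<open>g n\<close>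
  on \<open>A\<close>; off \<open>A\<close>, monotonicity gives
  \<open>g n \<le> g (next_in A n)\<close>.\<close>

lemma step_function_less_iff:
  assumes "infinite A" "mono g" "\<And>n. 0 < g n"
  shows "step_function g A n < g n \<longleftrightarrow> n \<in> A"
  using monoD[OF assms(2) next_in(2)[OF assms(1)], of n] assms(3)[of n]
  by (auto simp: step_function_def)

text \<open>The points where \<open>h\<close> exceeds the step function are unbounded. Such a point
  \<open>n\<close> in \<open>A\<close> already satisfies \<open>g n \<le> h n\<close>; one outside
  \<open>A\<close> passes the inequality on to the next element \<open>m\<close> of
  \<open>A\<close>, because \<open>g m < h n \<le> h m\<close>.\<close>

lemma infinite_le_of_not_le_star_step_function:
  assumes "infinite A" "mono h" "\<not> h \<le>\<^sup>* step_function g A"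
  shows "infinite {n \<in> A. g n \<le> h n}"
  unfolding infinite_nat_iff_unbounded_le
proof
  fix k
  have "infinite {n. step_function g A n < h n}"
    using assms(3) by (simp add: le_star_def not_le)
  then obtain n where n: "k \<le> n" "step_function g A n < h n"
    by (auto simp: infinite_nat_iff_unbounded_le)
  show "\<exists>m\<ge>k. m \<in> {n \<in> A. g n \<le> h n}"
  proof (cases "n \<in> A")
    case True
    then show ?thesis
      using n by (auto simp: step_function_def intro!: exI[of _ n])
  next
    case False
    let ?m = "next_in A n"
    have "g ?m < h n" using n False by (simp add: step_function_def)
    also have "h n \<le> h ?m" by (rule monoD[OF assms(2) next_in(2)[OF assms(1)]])
    finally show ?thesis
      using next_in[OF assms(1), of n] n(1) by (auto intro!: exI[of _ ?m])
  qed
qed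

lemma avoids_middles_step_function:
  assumes "mono g" "\<And>n. 0 < g n" "large S" "linearly_quasiordered (\<subseteq>\<^sup>*) S"
  shows "avoids_middles g (step_function g ` S)"
proof -
  have "{n. step_function g A n < g n} = A" if "A \<in> S" for A
    using step_function_less_iff[of A g] assms that by (auto simp: large_def)
  then show ?thesis
    using assms(3,4)
    by (auto simp: avoids_middles_iff large_def linearly_quasiordered_almost_subset_iff)
qed

lemma mono_majorant:
  fixes f :: "nat \<Rightarrow> nat"
  obtains g where "mono g" "\<And>n. f n \<le> g n"
proof
  show "mono (\<lambda>n. \<Sum>i\<le>n. f i)"
    by (intro monoI sum_mono2) auto
  show "f n \<le> (\<Sum>i\<le>n. f i)" for n
    by (rule member_le_sum) auto
qed

lemma le_star_trans_left:
  assumes "h \<le>\<^sup>* f" "\<And>n. h0 n \<le> h n"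
  shows "h0 \<le>\<^sup>* f"
  using assms(1) unfolding le_star_def
  by (rule finite_subset[rotated]) (use assms(2) order_trans in blast)

lemma exists_large_restrictions:
  fixes g :: "'i \<Rightarrow> nat \<Rightarrow> nat"
  assumes card: "|I| <o add(\<XX>, \<DD>)"
    and large: "\<And>i. i \<in> I \<Longrightarrow> large (F i \<parallel> {n. 0 < g i n})"
    and linear: "\<And>i. i \<in> I \<Longrightarrow> linearly_quasiordered (\<subseteq>\<^sup>*) (F i \<parallel> {n. 0 < g i n})"
  shows "\<exists>h. \<forall>i\<in>I. large (F i \<parallel> {n. g i n \<le> h n})"
proof -
  \<comment> \<open>Enlarging \<open>g i\<close> shrinks each set
    \<open>{n. g i n \<le> h n}\<close>, so it is enough to find \<open>h\<close> for the larger
    functions.\<close>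
  have "\<exists>g'. mono g' \<and> (\<forall>n. 0 < g' n \<and> g i n \<le> g' n)" for i
  proof -
    obtain g' where "mono g'" "\<And>n. Suc (g i n) \<le> g' n"
      using mono_majorant[of "\<lambda>n. Suc (g i n)"] by blast
    then show ?thesis
      by (metis Suc_leD Suc_le_eq gr_zeroI not_less0)
  qed
  then obtain G where G: "\<And>i. mono (G i)" "\<And>i n. 0 < G i n" "\<And>i n. g i n \<le> G i n"
    by metis
  \<comment> \<open>The chain is still cut out by the original \<open>g i\<close>: the enlarged
    \<open>G i\<close> is positive everywhere, and restricting to its support would leave
    \<open>F i\<close> as it was, for which no comparability is assumed.\<close>
  define Y where "Y i = step_function (G i) ` (F i \<parallel> {n. 0 < g i n})" for i
  have "Y ` I \<subseteq> \<XX>"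
    using avoids_middles_step_function[OF G(1,2) large linear]
    by (auto simp: Y_def class_X_def)
  moreover have "\<not> add(\<XX>, \<DD>) \<le>o |Y ` I|"
    using card card_of_image[of Y I] not_ordLess_ordLeq ordLeq_transitive by blast
  ultimately have "\<not> dominating (\<Union> (Y ` I))"
    using add_X_D_minimal(2) by blast
  then obtain h0 where h0: "\<And>f i. i \<in> I \<Longrightarrow> f \<in> Y i \<Longrightarrow> \<not> h0 \<le>\<^sup>* f"
    by (auto simp: dominating_def)
  \<comment> \<open>Carrying an inequality forward to the next element of a chain member needs a
    monotone \<open>h\<close>; a majorant of \<open>h0\<close> escapes every function that
    \<open>h0\<close> escapes.\<close>
  obtain h where h: "mono h" "\<And>n. h0 n \<le> h n"
    using mono_majorant by blast
  have "infinite (B \<inter> {n. g i n \<le> h n})" if "i \<in> I" "B \<in> F i" for i B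
  proof -
    let ?A = "B \<inter> {n. 0 < g i n}"
    have A: "?A \<in> F i \<parallel> {n. 0 < g i n}"
      using that(2) by (auto simp: restriction_def)
    then have "infinite ?A"
      using large[OF that(1)] by (simp add: large_def)
    moreover have "\<not> h \<le>\<^sup>* step_function (G i) ?A"
    proof
      assume "h \<le>\<^sup>* step_function (G i) ?A"
      then have "h0 \<le>\<^sup>* step_function (G i) ?A"
        using h(2) by (rule le_star_trans_left)
      moreover have "step_function (G i) ?A \<in> Y i"
        unfolding Y_def using A by (rule imageI)
      ultimately show False
        using h0[OF that(1)] by blast
    qed
    ultimately have "infinite {n \<in> ?A. G i n \<le> h n}"
      using h(1) by (intro infinite_le_of_not_le_star_step_function)
    moreover have "{n \<in> ?A. G i n \<le> h n} \<subseteq> B \<inter> {n. g i n \<le> h n}"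
      using order_trans[OF G(3)] by auto
    ultimately show ?thesis
      by (rule infinite_super[rotated])
  qed
  then show ?thesis
    by (auto simp: large_def restriction_def)
qed

text \<open>The assumption \<open>ex\<close> is applied to the chains of sets
  \<open>{n. f n < g i n}\<close>. On infinitely many points of such a set,
  \<open>f n < g i n \<le> h n\<close>, so the single function \<open>h\<close> is not almost
  bounded by any \<open>f\<close> in the union.\<close>

lemma not_dominating_Union:
  fixes Y :: "'i \<Rightarrow> (nat \<Rightarrow> nat) set"
  assumes Y: "\<And>i. i \<in> I \<Longrightarrow> Y i \<in> \<XX>"
    and ex: "\<And>(g :: 'i \<Rightarrow> nat \<Rightarrow> nat) F.
      (\<forall>i\<in>I. F i \<subseteq> infinite_sets \<and> large (F i \<parallel> {n. 0 < g i n}) \<and>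
          linearly_quasiordered (\<subseteq>\<^sup>*) (F i \<parallel> {n. 0 < g i n})) \<Longrightarrow>
      \<exists>h. \<forall>i\<in>I. large (F i \<parallel> {n. g i n \<le> h n})"
  shows "\<not> dominating (\<Union>i\<in>I. Y i)"
proof -
  obtain g where g: "\<And>i. i \<in> I \<Longrightarrow> avoids_middles (g i) (Y i)"
    using Y unfolding class_X_def mem_Collect_eq by metis
  define F where "F i = (\<lambda>f. {n. f n < g i n}) ` Y i" for i
  \<comment> \<open>Since \<open>f n < g i n\<close> forces \<open>0 < g i n\<close>, cutting to the
    support of \<open>g i\<close> loses nothing.\<close>
  have "F i \<parallel> {n. 0 < g i n} = F i" for i
  proof -
    have "{n. f n < g i n} \<inter> {n. 0 < g i n} = {n. f n < g i n}" for f
      by auto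
    then show ?thesis
      by (auto simp: restriction_def F_def)
  qed
  moreover have "F i \<subseteq> infinite_sets \<and> large (F i) \<and> linearly_quasiordered (\<subseteq>\<^sup>*) (F i)"
    if "i \<in> I" for i
    using g[OF that]
    by (auto simp: F_def avoids_middles_iff infinite_sets_def large_def
        linearly_quasiordered_almost_subset_iff)
  ultimately have "\<exists>h. \<forall>i\<in>I. large (F i \<parallel> {n. g i n \<le> h n})"
    by (intro ex) simp
  then obtain h where h: "\<And>i. i \<in> I \<Longrightarrow> large (F i \<parallel> {n. g i n \<le> h n})"
    by blast
  have "\<not> h \<le>\<^sup>* f" if "i \<in> I" "f \<in> Y i" for i f
  proof -
    have "infinite ({n. f n < g i n} \<inter> {n. g i n \<le> h n})"
      using h[OF that(1)] that(2) by (auto simp: large_def restriction_def F_def)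
    moreover have "{n. f n < g i n} \<inter> {n. g i n \<le> h n} \<subseteq> {n. \<not> h n \<le> f n}"
      by auto
    ultimately show ?thesis
      unfolding le_star_def using infinite_super by blast
  qed
  then show ?thesis
    by (auto simp: dominating_def)
qed

theorem theorem4p6:
  fixes \<kappa> :: "'k rel"
  assumes "Card_order \<kappa>"
  shows "\<kappa> <o add(\<XX>, \<DD>) \<longleftrightarrow>
    (\<forall>(g :: 'k \<Rightarrow> nat \<Rightarrow> nat) (F :: 'k \<Rightarrow> nat set set).
       (\<forall>\<alpha> \<in> Field \<kappa>.
          F \<alpha> \<subseteq> infinite_sets \<and>
          large (F \<alpha> \<parallel> {n. 0 < g \<alpha> n}) \<and>
          linearly_quasiordered (\<subseteq>\<^sup>*) (F \<alpha> \<parallel> {n. 0 < g \<alpha> n}))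
       \<longrightarrow> (\<exists>h :: nat \<Rightarrow> nat. \<forall>\<alpha> \<in> Field \<kappa>. large (F \<alpha> \<parallel> {n. g \<alpha> n \<le> h n})))"
    (is "_ \<longleftrightarrow> ?rhs")
proof
  have \<kappa>: "|Field \<kappa>| =o \<kappa>"
    by (rule card_of_Field_ordIso[OF assms])
  {
    assume "\<kappa> <o add(\<XX>, \<DD>)"
    then have "|Field \<kappa>| <o add(\<XX>, \<DD>)"
      using \<kappa> ordIso_ordLess_trans by blast
    then show ?rhs
      by (intro allI impI exists_large_restrictions) auto
  next
    assume rhs: ?rhs
    show "\<kappa> <o add(\<XX>, \<DD>)"
    proof (rule ccontr)
      assume "\<not> \<kappa> <o add(\<XX>, \<DD>)"
      obtain H where H: "H \<subseteq> \<XX>" "dominating (\<Union>H)" "add(\<XX>, \<DD>) = |H|"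
        using add_X_D_minimal(1) by blast
      have "|H| \<le>o \<kappa>"
        using \<open>\<not> \<kappa> <o add(\<XX>, \<DD>)\<close> assms H(3) card_of_Card_order[of H]
        by (simp add: not_ordLess_iff_ordLeq card_order_on_def)
      then have "|H| \<le>o |Field \<kappa>|"
        using \<kappa> ordIso_symmetric ordLeq_ordIso_trans by blast
      \<comment> \<open>Enumerating \<open>H\<close> by \<open>Field \<kappa>\<close>, possibly with
        repetitions, needs a surjection, which the cardinal inequality yields only for nonempty
        \<open>H\<close>.\<close>
      moreover have "H \<noteq> {}"
        using H(2) by (auto simp: dominating_def)
      ultimately obtain Y where Y: "Y ` Field \<kappa> = H"
        using card_of_ordLeq2 by metis
      have "\<not> dominating (\<Union>\<alpha>\<in>Field \<kappa>. Y \<alpha>)"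
        by (rule not_dominating_Union) (use Y H(1) rhs in auto)
      then show False
        using H(2) Y by simp
    qed
  }
qed

end
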